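(* Let $(x_{t+1},z_t,u_t,\gamma_t)_{t\ge 0}$ be generated by the Adaptive Three Operator Splitting algorithm (either Variant 1, or Variant 2 when $h$ is $\beta_h$-Lipschitz). Then for every $t\ge 0$ and every $(x,u)$ in the domain of $\mathcal{L}$, $$\mathcal{L}(\overline{x}_{t+1},u)-\mathcal{L}(x,\overline{u}_{t+1})\le\frac{\|z_0-x\|^2+\gamma_0^2\|u_0-u\|^2}{2\,s_{t+1}},$$ where $s_t=\sum_{i=0}^{t-1}\gamma_i$, $\overline{x}_t=\frac{1}{s_t}\sum_{i=0}^{t-1}\gamma_i x_{i+1}$ and $\overline{u}_t=\frac{1}{s_t}\sum_{i=0}^{t-1}\gamma_i u_{i+1}$.
   Context: Standing assumptions: $f:\mathbb{R}^p\to\mathbb{R}$ is convex and $L_f$-smooth (differentiable with $L_f$-Lipschitz gradient, $L_f>0$); $g,h:\mathbb{R}^p\to\,]-\infty,+\infty]$ are proper, lower semicontinuous and convex; the relative interiors of $\operatorname{dom} g$ and $\operatorname{dom} h$ have non-empty intersection. Notation: $\operatorname{prox}_{\gamma\varphi}(x)=\arg\min_{z\in\mathbb{R}^p}\{\varphi(z)+\frac{1}{2\gamma}\|x-z\|^2\}$; $h^*$ is the Fenchel conjugate of $h$; $\|\cdot\|$ is the Euclidean norm. The saddle function is $\mathcal{L}(x,u)=f(x)+g(x)+\langle x,u\rangle-h^*(u)$, with domain $\{(x,u): x\in\operatorname{dom} g,\ u\in\operatorname{dom} h^*\}$. Adaptive Three Operator Splitting algorithm. Input: $z_0,u_0\in\mathbb{R}^p$,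 an initial step-size $\gamma_0>0$, $\tau\in(0,1)$. For $t=0,1,2,\dots$: (1) Step-size search loop: compute $x_{t+1}=\operatorname{prox}_{\gamma_t g}(z_t-\gamma_t u_t-\gamma_t\nabla f(z_t))$. If the sufficient decrease condition $f(x_{t+1})\le Q_t(x_{t+1},\gamma_t)$ holds, exit the loop; otherwise replace $\gamma_t$ by $\tau\gamma_t$ and repeat. Here $$Q_t(x,\gamma)=f(z_t)+\langle\nabla f(z_t),x-z_t\rangle+\frac{1}{2\gamma}\|x-z_t\|^2 .$$ (2) Set $z_{t+1}=\operatorname{prox}_{\gamma_t h}(x_{t+1}+\gamma_t u_t)$ and $u_{t+1}=u_t+(x_{t+1}-z_{t+1})/\gamma_t$. (3) Initialize the next step-size. Variant 1: $\gamma_{t+1}=\gamma_t$. Variant 2 (only allowed if $h$ is $\beta_h$-Lipschitz): with $\delta_t=Q_t(x_{t+1},\gamma_t)-f(x_{t+1})$, choose any $\gamma_{t+1}\in\big[\gamma_t,\sqrt{\gamma_t^2+\gamma_t\delta_t(2\beta_h)^{-2}}\,\big]$. The search loop terminates at every iteration (the condition holds whenever $\gamma_t\le 1/L_f$). In the statement, $\gamma_t$ (including $\gamma_0$) denotes the value at exit of the search loop of iteration $t$. *)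

theory Defs
  imports "HOL-Analysis.Analysis" "HOL-Library.While_Combinator"
begin

subsection \<open>Convex analysis of extended-real-valued functions\<close>

definition eff_dom :: "('a \<Rightarrow> ereal) \<Rightarrow> 'a set" where
  "eff_dom \<phi> = {x. \<phi> x < \<infinity>}"

definition proper_fun :: "('a \<Rightarrow> ereal) \<Rightarrow> bool" where
  "proper_fun \<phi> \<longleftrightarrow> (\<forall>x. \<phi> x \<noteq> -\<infinity>) \<and> eff_dom \<phi> \<noteq> {}"

definition lsc_fun :: "('a::topological_space \<Rightarrow> ereal) \<Rightarrow> bool" where
  "lsc_fun \<phi> \<longleftrightarrow> (\<forall>x. \<phi> x \<le> Liminf (at x) \<phi>)"

text \<open>Only used together with \<^const>\<open>proper_fun\<close>, so that the value \<open>-\<infinity>\<close> does not occur; note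
  \<open>0 * \<infinity> = 0\<close> in \<^typ>\<open>ereal\<close>.\<close>

definition convex_fun :: "('a::real_vector \<Rightarrow> ereal) \<Rightarrow> bool" where
  "convex_fun \<phi> \<longleftrightarrow> (\<forall>x y. \<forall>a\<ge>0. \<forall>b\<ge>0. a + b = 1 \<longrightarrow>
     \<phi> (a *\<^sub>R x + b *\<^sub>R y) \<le> ereal a * \<phi> x + ereal b * \<phi> y)"

definition fenchel_conj :: "('a::real_inner \<Rightarrow> ereal) \<Rightarrow> 'a \<Rightarrow> ereal" where
  "fenchel_conj \<phi> u = (SUP x. ereal (x \<bullet> u) - \<phi> x)"

text \<open>\<open>prox \<gamma> \<phi>\<close> is the proximal operator of \<open>\<gamma>\<phi>\<close>.\<close>

definition prox :: "real \<Rightarrow> ('a::real_normed_vector \<Rightarrow> ereal) \<Rightarrow> 'a \<Rightarrow> 'a" where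
  "prox \<gamma> \<phi> x = (ARG_MIN (\<lambda>z. \<phi> z + ereal (1 / (2 * \<gamma>) * (norm (x - z))\<^sup>2)) z. True)"

text \<open>Real-valuedness everywhere is part of the Lipschitz property of an extended-real-valued
  function.\<close>

definition lipschitz_fun :: "real \<Rightarrow> ('a::metric_space \<Rightarrow> ereal) \<Rightarrow> bool" where
  "lipschitz_fun \<beta> \<phi> \<longleftrightarrow>
     (\<forall>x. \<bar>\<phi> x\<bar> \<noteq> \<infinity>) \<and> \<beta>-lipschitz_on UNIV (\<lambda>x. real_of_ereal (\<phi> x))"


subsection \<open>Smooth functions\<close>

definition grad :: "('a::real_inner \<Rightarrow> real) \<Rightarrow> 'a \<Rightarrow> 'a" where
  "grad f x = (THE D. GDERIV f x :> D)"

definition smooth_fun :: "real \<Rightarrow> ('a::real_inner \<Rightarrow> real) \<Rightarrow> bool" where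
  "smooth_fun L f \<longleftrightarrow> (\<forall>x. f differentiable (at x)) \<and> L-lipschitz_on UNIV (grad f)"


subsection \<open>The saddle function\<close>

definition saddle ::
  "('a::real_inner \<Rightarrow> real) \<Rightarrow> ('a \<Rightarrow> ereal) \<Rightarrow> ('a \<Rightarrow> ereal) \<Rightarrow> 'a \<Rightarrow> 'a \<Rightarrow> ereal" where
  "saddle f g h x u = ereal (f x) + g x + ereal (x \<bullet> u) - fenchel_conj h u"

definition saddle_dom :: "('a::real_inner \<Rightarrow> ereal) \<Rightarrow> ('a \<Rightarrow> ereal) \<Rightarrow> ('a \<times> 'a) set" where
  "saddle_dom g h = eff_dom g \<times> eff_dom (fenchel_conj h)"


subsection \<open>Adaptive Three Operator Splitting\<close>

definition quad_model :: "('a::real_inner \<Rightarrow> real) \<Rightarrow> 'a \<Rightarrow> 'a \<Rightarrow> real \<Rightarrow> real" where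
  "quad_model f z x \<gamma> = f z + grad f z \<bullet> (x - z) + 1 / (2 * \<gamma>) * (norm (x - z))\<^sup>2"

definition primal_step ::
  "('a::real_inner \<Rightarrow> real) \<Rightarrow> ('a \<Rightarrow> ereal) \<Rightarrow> 'a \<Rightarrow> 'a \<Rightarrow> real \<Rightarrow> 'a" where
  "primal_step f g z u \<gamma> = prox \<gamma> g (z - \<gamma> *\<^sub>R u - \<gamma> *\<^sub>R grad f z)"

definition step_search ::
  "('a::real_inner \<Rightarrow> real) \<Rightarrow> ('a \<Rightarrow> ereal) \<Rightarrow> real \<Rightarrow> 'a \<Rightarrow> 'a \<Rightarrow> real \<Rightarrow> real" where
  "step_search f g \<tau> z u \<gamma>init =
     while (\<lambda>\<gamma>. \<not> f (primal_step f g z u \<gamma>) \<le> quad_model f z (primal_step f g z u \<gamma>) \<gamma>)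
       (\<lambda>\<gamma>. \<tau> * \<gamma>) \<gamma>init"

text \<open>Below, \<open>\<gamma>init t\<close> is the step-size with which the search loop of iteration \<open>t\<close> is entered and
  \<open>\<gamma> t\<close> its value when the loop exits. The value \<open>x 0\<close> is irrelevant.\<close>

definition atos_iterates ::
  "('a::real_inner \<Rightarrow> real) \<Rightarrow> ('a \<Rightarrow> ereal) \<Rightarrow> ('a \<Rightarrow> ereal) \<Rightarrow> real \<Rightarrow>
   (nat \<Rightarrow> real) \<Rightarrow> (nat \<Rightarrow> real) \<Rightarrow> (nat \<Rightarrow> 'a) \<Rightarrow> (nat \<Rightarrow> 'a) \<Rightarrow> (nat \<Rightarrow> 'a) \<Rightarrow> bool" where
  "atos_iterates f g h \<tau> \<gamma>init \<gamma> x z u \<longleftrightarrow> (\<forall>t.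
     \<gamma> t = step_search f g \<tau> (z t) (u t) (\<gamma>init t) \<and>
     x (Suc t) = primal_step f g (z t) (u t) (\<gamma> t) \<and>
     z (Suc t) = prox (\<gamma> t) h (x (Suc t) + \<gamma> t *\<^sub>R u t) \<and>
     u (Suc t) = u t + (1 / \<gamma> t) *\<^sub>R (x (Suc t) - z (Suc t)))"

definition atos_variant1 :: "(nat \<Rightarrow> real) \<Rightarrow> (nat \<Rightarrow> real) \<Rightarrow> bool" where
  "atos_variant1 \<gamma>init \<gamma> \<longleftrightarrow> (\<forall>t. \<gamma>init (Suc t) = \<gamma> t)"

definition atos_variant2 ::
  "('a::real_inner \<Rightarrow> real) \<Rightarrow> real \<Rightarrow> (nat \<Rightarrow> real) \<Rightarrow> (nat \<Rightarrow> real) \<Rightarrow> (nat \<Rightarrow> 'a) \<Rightarrow> (nat \<Rightarrow> 'a) \<Rightarrow> bool"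
where
  "atos_variant2 f \<beta> \<gamma>init \<gamma> x z \<longleftrightarrow> (\<forall>t.
     let \<delta> = quad_model f (z t) (x (Suc t)) (\<gamma> t) - f (x (Suc t))
     in \<gamma>init (Suc t) \<in> {\<gamma> t .. sqrt ((\<gamma> t)\<^sup>2 + \<gamma> t * \<delta> * (2 * \<beta>) powi (-2))})"

definition step_sum :: "(nat \<Rightarrow> real) \<Rightarrow> nat \<Rightarrow> real" where
  "step_sum \<gamma> t = (\<Sum>i<t. \<gamma> i)"

definition ergodic_avg :: "(nat \<Rightarrow> real) \<Rightarrow> (nat \<Rightarrow> 'a::real_vector) \<Rightarrow> nat \<Rightarrow> 'a" where
  "ergodic_avg \<gamma> v t = (1 / step_sum \<gamma> t) *\<^sub>R (\<Sum>i<t. \<gamma> i *\<^sub>R v (Suc i))"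

end

theory Submission
  imports Defs "HOL-Real_Asymp.Real_Asymp"
begin

text \<open>
  One iteration bounds the saddle gap, multiplied by the step-size, by a decrease of the distance to the
  reference point \<open>(x', u')\<close>. Three subgradient inequalities combine: the variational inequality of
  the proximal step for \<open>g\<close>; convexity of \<open>f\<close> at \<open>z t\<close> together with the acceptance test, which
  replaces the smoothness estimate; and the fact that the proximal step for \<open>h\<close> makes \<open>u (Suc t)\<close>
  a subgradient of \<open>h\<close> at \<open>z (Suc t)\<close>. The last fact gives equality in the Fenchel-Young inequality, so
  \<open>h\<^sup>*\<close> is known exactly along the iterates. All remaining inner products then telescope into squares
  (\<open>saddle_gap_algebra\<close>), in the metric
  \<open>\<parallel>z - x'\<parallel>\<^sup>2 + \<gamma>\<^sup>2 \<parallel>u - u'\<parallel>\<^sup>2\<close>, and the slack \<open>\<delta>\<close> of the acceptance test is left over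
  as a gain \<open>\<gamma> \<delta>\<close>.

  The weight \<open>\<gamma>\<^sup>2\<close> of the dual part changes from one iteration to the next. It never grows in the first
  variant. In the second variant the Lipschitz constant of \<open>h\<close> confines the domain of \<open>h\<^sup>*\<close> to a
  ball, and the allowed growth of the step-size costs no more than the gain
  (\<open>dual_distance_growth\<close>). Hence the bounds telescope over the iterations
  (\<open>sum_gap_le_initial_energy\<close>), and Jensen's inequality, applied to the convex function
  \<open>\<L>(\<cdot>, u')\<close> and the concave function \<open>\<L>(x', \<cdot>)\<close>, passes to the ergodic averages.

  Two facts make the iteration meaningful. The proximal point exists because a proper convex lower
  semicontinuous function decreases at most linearly, so that adding a quadratic makes it coercive
  (\<open>prox_minimizes\<close>). The search loop stops because, by the descent lemma, every step-size up to
  \<open>1 / L\<close> is accepted (\<open>step_search_accepts\<close>).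
\<close>


section \<open>Existence and variational inequality of the proximal point\<close>

text \<open>
  Closedness of the epigraph is insensitive to adding a continuous function, which only shears the
  epigraph. It thus yields closed sublevel sets for the objective of the proximal problem.
\<close>

lemma lsc_fun_closed_epigraph:
  fixes \<phi> :: "'a::topological_space \<Rightarrow> ereal"
  assumes "lsc_fun \<phi>"
  shows "closed {p. \<phi> (fst p) \<le> ereal (snd p)}"
proof -
  have "open {p. ereal (snd p) < \<phi> (fst p)}"
  proof (subst open_subopen, intro ballI)
    fix p assume "p \<in> {p. ereal (snd p) < \<phi> (fst p)}"
    then obtain r where r: "snd p < r" "ereal r < \<phi> (fst p)"
      by (auto dest: ereal_dense2)
    have "\<forall>\<^sub>F w in at (fst p). ereal r < \<phi> w"
      using assms r(2) unfolding lsc_fun_def le_Liminf_iff by (meson less_le_trans)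
    with r(2) have "\<forall>\<^sub>F w in nhds (fst p). ereal r < \<phi> w"
      by (simp add: eventually_nhds_conv_at)
    then obtain U where U: "open U" "fst p \<in> U" "\<And>w. w \<in> U \<Longrightarrow> ereal r < \<phi> w"
      by (auto simp: eventually_nhds)
    have "open (U \<times> {..<r})" "p \<in> U \<times> {..<r}"
      using U r by (auto simp: open_Times mem_Times_iff)
    moreover have "U \<times> {..<r} \<subseteq> {p. ereal (snd p) < \<phi> (fst p)}"
    proof (clarsimp)
      fix w s assume "w \<in> U" "s < r"
      then show "ereal s < \<phi> w" using U(3)[of w] by (meson less_ereal.simps(1) less_trans)
    qed
    ultimately show "\<exists>T. open T \<and> p \<in> T \<and> T \<subseteq> {p. ereal (snd p) < \<phi> (fst p)}"
      by blast
  qed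
  then show ?thesis
    by (simp add: closed_def Compl_eq not_le)
qed

lemma lsc_fun_closed_sublevel:
  fixes \<phi> :: "'a::topological_space \<Rightarrow> ereal"
  assumes "lsc_fun \<phi>" and q: "continuous_on UNIV q"
  shows "closed {y. \<phi> y + ereal (q y) \<le> ereal c}"
proof -
  have "\<phi> y + ereal (q y) \<le> ereal c \<longleftrightarrow> \<phi> y \<le> ereal (c - q y)" for y
    by (cases "\<phi> y") auto
  then have "{y. \<phi> y + ereal (q y) \<le> ereal c}
      = (\<lambda>y. (y, c - q y)) -` {p. \<phi> (fst p) \<le> ereal (snd p)}"
    by auto
  moreover have "closed \<dots>"
    by (intro closed_vimage lsc_fun_closed_epigraph assms continuous_intros)
  ultimately show ?thesis by simp
qed

text \<open>
  The sublevel sets at attained values form a chain of nonempty compact sets; any point common to all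
  of them is a minimizer.
\<close>

lemma attains_min_on_compact:
  fixes F :: "'a::heine_borel \<Rightarrow> ereal"
  assumes closed: "\<And>c. closed {y. F y \<le> ereal c}"
    and fin: "\<And>y. F y \<noteq> -\<infinity>"
    and K: "compact K" "K \<noteq> {}"
  shows "\<exists>p\<in>K. \<forall>y\<in>K. F p \<le> F y"
proof (cases "\<exists>w\<in>K. F w < \<infinity>")
  case False
  then show ?thesis using K(2) by auto
next
  case True
  define \<F> where "\<F> = (\<lambda>w. {y\<in>K. F y \<le> F w}) ` {w\<in>K. F w < \<infinity>}"
  have cl: "closed {y\<in>K. F y \<le> F w}" if w: "F w < \<infinity>" for w
  proof -
    obtain c where "F w = ereal c" using w fin[of w] by (cases "F w") auto
    then have "{y\<in>K. F y \<le> F w} = K \<inter> {y. F y \<le> ereal c}" by auto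
    then show ?thesis using closed[of c] K(1) by (simp add: closed_Int compact_imp_closed)
  qed
  from True obtain w where w: "w \<in> K" "F w < \<infinity>" by blast
  have "\<Inter>\<F> \<noteq> {}"
  proof (rule bounded_closed_chain)
    show "{y\<in>K. F y \<le> F w} \<in> \<F>" using w by (auto simp: \<F>_def)
    show "bounded {y\<in>K. F y \<le> F w}"
      using K(1) by (auto intro: bounded_subset compact_imp_bounded)
    show "closed S" if "S \<in> \<F>" for S using that cl by (auto simp: \<F>_def)
    show "{} \<notin> \<F>" unfolding \<F>_def by (auto simp: set_eq_iff)
    show "S \<subseteq> T \<or> T \<subseteq> S" if ST: "S \<in> \<F> \<and> T \<in> \<F>" for S T
    proof -
      obtain a b where "S = {y\<in>K. F y \<le> F a}" "T = {y\<in>K. F y \<le> F b}"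
        using ST by (auto simp: \<F>_def)
      then show ?thesis using linear[of "F a" "F b"] by (auto intro: order_trans)
    qed
  qed
  then obtain p where p: "p \<in> \<Inter>\<F>" by blast
  have "F p \<le> F y" if "y \<in> K" for y
    using p that by (cases "F y < \<infinity>") (auto simp: \<F>_def)
  moreover have "p \<in> K" using p w by (auto simp: \<F>_def)
  ultimately show ?thesis by blast
qed

lemma eff_dom_real:
  assumes "proper_fun \<phi>" "y \<in> eff_dom \<phi>"
  shows "\<phi> y = ereal (real_of_ereal (\<phi> y))"
  using assms by (cases "\<phi> y") (auto simp: proper_fun_def eff_dom_def)

text \<open>
  A lower bound on the unit ball propagates outwards along rays: a point of the unit sphere lies between
  the centre \<open>x0\<close> and the remote point, so by convexity a steep descent further out would violate
  the bound on the sphere.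
\<close>

lemma convex_fun_linear_minorant:
  fixes \<phi> :: "'a::euclidean_space \<Rightarrow> ereal"
  assumes proper: "proper_fun \<phi>" and lsc: "lsc_fun \<phi>" and conv: "convex_fun \<phi>"
    and x0: "\<phi> x0 = ereal M"
  obtains b where "\<And>y. ereal (M - b - b * norm (y - x0)) \<le> \<phi> y" "0 \<le> b"
proof -
  have "\<exists>p\<in>cball x0 1. \<forall>y\<in>cball x0 1. \<phi> p \<le> \<phi> y"
  proof (rule attains_min_on_compact)
    show "closed {y. \<phi> y \<le> ereal c}" for c
      using lsc_fun_closed_sublevel[OF lsc, of "\<lambda>_. 0" c] by (simp add: zero_ereal_def[symmetric])
  qed (use proper in \<open>auto simp: proper_fun_def\<close>)
  then obtain p where p: "\<And>y. y \<in> cball x0 1 \<Longrightarrow> \<phi> p \<le> \<phi> y" by blast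
  have "\<phi> p \<le> ereal M" using p[of x0] x0 by simp
  then obtain m where m: "\<phi> p = ereal m" "m \<le> M"
    using proper by (cases "\<phi> p") (auto simp: proper_fun_def)
  show thesis
  proof (rule that[of "M - m"])
    show "0 \<le> M - m" using m by simp
    show "ereal (M - (M - m) - (M - m) * norm (y - x0)) \<le> \<phi> y" for y
    proof (cases "norm (y - x0) \<le> 1")
      case True
      have "m - (M - m) * norm (y - x0) \<le> m" using m by simp
      then have "ereal (M - (M - m) - (M - m) * norm (y - x0)) \<le> \<phi> p"
        using m(1) by simp
      also have "\<dots> \<le> \<phi> y" using True by (intro p) (simp add: dist_norm norm_minus_commute)
      finally show ?thesis .
    next
      case False
      define r where "r = norm (y - x0)"
      have r: "1 < r" using False by (simp add: r_def)
      \<comment> \<open>The point where the segment from \<open>x0\<close> to \<open>y\<close> crosses the unit sphere around \<open>x0\<close>.\<close>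
      define w where "w = (1 - 1 / r) *\<^sub>R x0 + (1 / r) *\<^sub>R y"
      have "w - x0 = (1 / r) *\<^sub>R (y - x0)"
        by (simp add: w_def algebra_simps)
      then have "norm (w - x0) = \<bar>1 / r\<bar> * r" by (simp only: norm_scaleR r_def)
      then have "norm (w - x0) = 1" using r by simp
      then have "\<phi> p \<le> \<phi> w" by (intro p) (simp add: dist_norm norm_minus_commute)
      also have "\<phi> w \<le> ereal (1 - 1 / r) * \<phi> x0 + ereal (1 / r) * \<phi> y"
        using conv[unfolded convex_fun_def, rule_format, of "1 - 1/r" "1/r" x0 y] r
        unfolding w_def by simp
      finally have *: "ereal m \<le> ereal ((1 - 1 / r) * M) + ereal (1 / r) * \<phi> y"
        using m x0 by simp
      show ?thesis
      proof (cases "\<phi> y")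
        case (real s)
        have "m \<le> (1 - 1 / r) * M + (1 / r) * s" using * real by simp
        then have "r * m \<le> r * ((1 - 1 / r) * M + (1 / r) * s)"
          using r by (intro mult_left_mono) auto
        also have "\<dots> = (r - 1) * M + s" using r by (simp add: field_simps)
        finally have "M - (M - m) * r \<le> s" by (simp add: algebra_simps)
        then show ?thesis using real m by (simp add: r_def)
      qed (use proper in \<open>auto simp: proper_fun_def\<close>)
    qed
  qed
qed

text \<open>
  The linear minorant and the quadratic term make the objective exceed its value at some \<open>x0\<close> outside
  a large ball, so a minimizer over that ball is a global one.
\<close>

lemma prox_minimizes:
  fixes \<phi> :: "'a::euclidean_space \<Rightarrow> ereal"
  assumes proper: "proper_fun \<phi>" and lsc: "lsc_fun \<phi>" and conv: "convex_fun \<phi>" and "0 < \<gamma>"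
  defines "F \<equiv> \<lambda>v z. \<phi> z + ereal (1 / (2 * \<gamma>) * (norm (v - z))\<^sup>2)"
  shows "F v (prox \<gamma> \<phi> v) \<le> F v y"
proof -
  have cl: "closed {y. F v y \<le> ereal c}" for c
    unfolding F_def by (intro lsc_fun_closed_sublevel lsc continuous_intros)
  have nm: "F v y \<noteq> -\<infinity>" for y using proper by (auto simp: F_def proper_fun_def)
  obtain x0 where x0d: "x0 \<in> eff_dom \<phi>" using proper by (auto simp: proper_fun_def)
  then obtain M where x0: "\<phi> x0 = ereal M" using eff_dom_real[OF proper] by metis
  obtain b where b: "\<And>y. ereal (M - b - b * norm (y - x0)) \<le> \<phi> y" "0 \<le> b"
    using convex_fun_linear_minorant[OF proper lsc conv x0] by metis
  define C where "C = M + 1 / (2 * \<gamma>) * (norm (v - x0))\<^sup>2"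
  have FC: "F v x0 = ereal C" by (simp add: F_def x0 C_def)
  define k d where "k = 1 / (2 * \<gamma>)" and "d = norm (v - x0)"
  have "k > 0" using \<open>0 < \<gamma>\<close> by (simp add: k_def)
  then have "filterlim (\<lambda>r. (M - b - b * r) + k * (r - d)\<^sup>2) at_top at_top"
    by real_asymp
  then have "\<forall>\<^sub>F r in at_top. C \<le> (M - b - b * r) + k * (r - d)\<^sup>2"
    by (simp add: filterlim_at_top)
  then obtain R where R: "\<And>r. r \<ge> R \<Longrightarrow> C \<le> (M - b - b * r) + k * (r - d)\<^sup>2"
    by (auto simp: eventually_at_top_linorder)
  define R' where "R' = max R d"
  \<comment> \<open>The bound \<open>d \<le> R'\<close> makes \<open>r - d\<close> nonnegative, so that it may be squared.\<close>
  have out: "ereal C \<le> F v y" if "norm (y - x0) > R'" for y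
  proof -
    define r where "r = norm (y - x0)"
    have r: "r \<ge> R" "r \<ge> d" using that by (auto simp: r_def R'_def)
    have "r - d \<le> norm (v - y)"
      using norm_triangle_ineq2[of "y - x0" "v - x0"]
      by (simp add: r_def d_def norm_minus_commute)
    then have "k * (r - d)\<^sup>2 \<le> k * (norm (v - y))\<^sup>2"
      using r \<open>k > 0\<close> by (intro mult_left_mono power_mono) auto
    then have "ereal C \<le> ereal (M - b - b * r) + ereal (k * (norm (v - y))\<^sup>2)"
      using R[OF r(1)] by simp
    also have "\<dots> \<le> F v y" unfolding F_def k_def r_def
      by (intro add_right_mono b)
    finally show ?thesis .
  qed
  have "R' \<ge> 0" by (simp add: R'_def d_def le_max_iff_disj)
  then have x0K: "x0 \<in> cball x0 R'" by simp
  have "\<exists>p\<in>cball x0 R'. \<forall>y\<in>cball x0 R'. F v p \<le> F v y"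
    using x0K by (intro attains_min_on_compact cl nm) auto
  then obtain p where p: "\<And>y. y \<in> cball x0 R' \<Longrightarrow> F v p \<le> F v y" by blast
  have "F v p \<le> F v y" for y
  proof (cases "y \<in> cball x0 R'")
    case False
    then have "ereal C \<le> F v y" by (intro out) (simp add: dist_norm norm_minus_commute)
    then show ?thesis using p[OF x0K] FC by simp
  qed (rule p)
  then have "is_arg_min (F v) (\<lambda>_. True) p" by (auto simp: is_arg_min_def not_less)
  then have "is_arg_min (F v) (\<lambda>_. True) (prox \<gamma> \<phi> v)"
    unfolding prox_def arg_min_def F_def by (rule someI)
  then show ?thesis by (simp add: is_arg_min_def not_less)
qed

lemma nonpos_of_le_small_multiples:
  fixes A B :: real
  assumes "\<And>s. 0 < s \<Longrightarrow> s < 1 \<Longrightarrow> A \<le> s * B"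
  shows "A \<le> 0"
proof (rule tendsto_lowerbound)
  show "((\<lambda>s. s * B) \<longlongrightarrow> 0) (at_right 0)" by real_asymp
  have "\<forall>\<^sub>F s in at_right 0. 0 < s \<and> s < (1::real)"
    by (auto simp: eventually_at_right_field intro!: exI[of _ 1])
  then show "\<forall>\<^sub>F s in at_right 0. A \<le> s * B"
    by eventually_elim (use assms in auto)
qed simp

text \<open>
  The first-order optimality condition. The minimizer \<open>p\<close> is compared with the points
  \<open>(1 - s) p + s w\<close>; after division by \<open>s\<close> the second-order remainder vanishes as \<open>s\<close> tends
  to \<open>0\<close>.
\<close>

lemma prox_variational_inequality:
  fixes \<phi> :: "'a::euclidean_space \<Rightarrow> ereal"
  assumes proper: "proper_fun \<phi>" and lsc: "lsc_fun \<phi>" and conv: "convex_fun \<phi>" and \<gamma>: "0 < \<gamma>"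
  shows prox_in_eff_dom: "prox \<gamma> \<phi> v \<in> eff_dom \<phi>"
    and "\<phi> (prox \<gamma> \<phi> v) + ereal ((1 / \<gamma>) * ((v - prox \<gamma> \<phi> v) \<bullet> (w - prox \<gamma> \<phi> v))) \<le> \<phi> w"
proof -
  define p where "p = prox \<gamma> \<phi> v"
  note min = prox_minimizes[OF proper lsc conv \<gamma>, of v, folded p_def]
  obtain x0 where x0: "x0 \<in> eff_dom \<phi>" using proper by (auto simp: proper_fun_def)
  have dom: "p \<in> eff_dom \<phi>"
    using min[of x0] x0 by (cases "\<phi> p"; cases "\<phi> x0") (auto simp: eff_dom_def)
  then show "prox \<gamma> \<phi> v \<in> eff_dom \<phi>" by (simp add: p_def)
  obtain P where P: "\<phi> p = ereal P" using eff_dom_real[OF proper dom] by metis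
  have "\<phi> p + ereal ((1 / \<gamma>) * ((v - p) \<bullet> (w - p))) \<le> \<phi> w"
  proof (cases "\<phi> w")
    case (real W)
    have "P + (1 / \<gamma>) * ((v - p) \<bullet> (w - p)) - W \<le> 0"
    proof (rule nonpos_of_le_small_multiples)
      fix s :: real assume s: "0 < s" "s < 1"
      define y where "y = (1 - s) *\<^sub>R p + s *\<^sub>R w"
      have "\<phi> y \<le> ereal (1 - s) * \<phi> p + ereal s * \<phi> w"
        using conv[unfolded convex_fun_def, rule_format, of "1 - s" s p w] s by (simp add: y_def)
      also have "\<dots> = ereal ((1 - s) * P + s * W)" by (simp add: P real)
      finally have cy: "\<phi> y \<le> ereal ((1 - s) * P + s * W)" .
      have "ereal (P + 1 / (2 * \<gamma>) * (norm (v - p))\<^sup>2)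
          \<le> \<phi> y + ereal (1 / (2 * \<gamma>) * (norm (v - y))\<^sup>2)"
        using min[of y] P by simp
      also have "\<dots> \<le> ereal ((1 - s) * P + s * W) + ereal (1 / (2 * \<gamma>) * (norm (v - y))\<^sup>2)"
        by (intro add_right_mono cy)
      finally have 1: "P + 1 / (2 * \<gamma>) * (norm (v - p))\<^sup>2
          \<le> (1 - s) * P + s * W + 1 / (2 * \<gamma>) * (norm (v - y))\<^sup>2" by simp
      have vy: "v - y = (v - p) - s *\<^sub>R (w - p)" by (simp add: y_def algebra_simps)
      have sq: "(norm (a - c))\<^sup>2 = (norm a)\<^sup>2 - 2 * (a \<bullet> c) + (norm c)\<^sup>2" for a c :: 'a
        by (simp add: power2_norm_eq_inner inner_diff_left inner_diff_right inner_commute)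
      have "(norm (v - y))\<^sup>2
          = (norm (v - p))\<^sup>2 - 2 * s * ((v - p) \<bullet> (w - p)) + s\<^sup>2 * (norm (w - p))\<^sup>2"
        unfolding vy sq[of "v - p"] by (simp add: power_mult_distrib)
      then have N: "(norm (v - y))\<^sup>2 - (norm (v - p))\<^sup>2
          = s * (s * (norm (w - p))\<^sup>2) - 2 * (s * ((v - p) \<bullet> (w - p)))"
        by (simp add: power2_eq_square)
      have "s * (P - W) \<le> ((norm (v - y))\<^sup>2 - (norm (v - p))\<^sup>2) / (2 * \<gamma>)"
        using 1 by (simp add: diff_divide_distrib algebra_simps)
      also note N
      finally have "s * (P - W) + s * ((v - p) \<bullet> (w - p)) / \<gamma> \<le> s * (s * (norm (w - p))\<^sup>2) / (2 * \<gamma>)"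
        by (simp add: diff_divide_distrib)
      then have "s * (P + (1 / \<gamma>) * ((v - p) \<bullet> (w - p)) - W)
          \<le> s * (s * ((norm (w - p))\<^sup>2 / (2 * \<gamma>)))"
        by (simp only: distrib_left right_diff_distrib times_divide_eq_right mult_1_left
            times_divide_eq_left)
      then show "P + (1 / \<gamma>) * ((v - p) \<bullet> (w - p)) - W \<le> s * ((norm (w - p))\<^sup>2 / (2 * \<gamma>))"
        using s(1) by (rule mult_left_le_imp_le)
    qed
    then show ?thesis by (simp add: P real)
  qed (use proper in \<open>auto simp: proper_fun_def\<close>)
  then show "\<phi> (prox \<gamma> \<phi> v) + ereal ((1 / \<gamma>) * ((v - prox \<gamma> \<phi> v) \<bullet> (w - prox \<gamma> \<phi> v))) \<le> \<phi> w"
    by (simp add: p_def)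
qed


section \<open>Smooth convex functions\<close>

text \<open>
  The Riesz representation of the derivative in an orthonormal basis shows that the description defining
  the gradient has exactly one solution.
\<close>

lemma gderiv_grad:
  fixes f :: "'a::euclidean_space \<Rightarrow> real"
  assumes "f differentiable (at y)"
  shows "GDERIV f y :> grad f y"
proof -
  obtain A where A: "(f has_derivative A) (at y)" using assms by (auto simp: differentiable_def)
  interpret bounded_linear A using A by (rule has_derivative_bounded_linear)
  define D where "D = (\<Sum>i\<in>Basis. A i *\<^sub>R i)"
  have "A v = v \<bullet> D" for v
  proof -
    have "A v = A (\<Sum>i\<in>Basis. (v \<bullet> i) *\<^sub>R i)" by (simp add: euclidean_representation)
    also have "\<dots> = (\<Sum>i\<in>Basis. (v \<bullet> i) * A i)" by (simp add: sum scaleR)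
    also have "\<dots> = v \<bullet> D" by (simp add: D_def inner_sum_right mult.commute)
    finally show ?thesis .
  qed
  then have "A = (\<lambda>v. v \<bullet> D)" by (rule ext)
  then have D: "GDERIV f y :> D" using A by (simp add: gderiv_def)
  have "E = D" if "GDERIV f y :> E" for E
  proof -
    have "(\<lambda>h. h \<bullet> E) = (\<lambda>h. h \<bullet> D)"
      using that D unfolding gderiv_def by (rule has_derivative_unique)
    then have "(E - D) \<bullet> E = (E - D) \<bullet> D" by metis
    then have "(E - D) \<bullet> (E - D) = 0" by (simp add: inner_diff_right)
    then show ?thesis by simp
  qed
  with D show ?thesis unfolding grad_def by (rule theI)
qed

lemma smooth_fun_deriv_along_line:
  fixes f :: "'a::euclidean_space \<Rightarrow> real"
  assumes "smooth_fun L f"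
  shows "((\<lambda>s. f (y + s *\<^sub>R d)) has_real_derivative grad f (y + s *\<^sub>R d) \<bullet> d) (at s)"
proof -
  have "GDERIV f (y + s *\<^sub>R d) :> grad f (y + s *\<^sub>R d)"
    using assms by (intro gderiv_grad) (simp add: smooth_fun_def)
  then have f: "(f has_derivative (\<lambda>h. h \<bullet> grad f (y + s *\<^sub>R d))) (at (y + s *\<^sub>R d))"
    by (simp add: gderiv_def)
  have line: "((\<lambda>s. y + s *\<^sub>R d) has_derivative (\<lambda>h. h *\<^sub>R d)) (at s)"
    by (auto intro!: derivative_eq_intros)
  have "((\<lambda>s. f (y + s *\<^sub>R d)) has_derivative (\<lambda>h. (h *\<^sub>R d) \<bullet> grad f (y + s *\<^sub>R d))) (at s)"
    by (rule has_derivative_compose[OF line f])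
  then show ?thesis
    by (rule has_derivative_imp_has_field_derivative) (simp add: inner_commute)
qed

lemma convex_gradient_inequality:
  fixes f :: "'a::euclidean_space \<Rightarrow> real"
  assumes "convex_on UNIV f" "smooth_fun L f"
  shows "f y + grad f y \<bullet> (w - y) \<le> f w"
proof -
  define d where "d = w - y"
  have cv: "convex_on UNIV (\<lambda>s. f (y + s *\<^sub>R d))"
  proof (rule convex_onI)
    fix t a b :: real assume t: "0 < t" "t < 1"
    have "y + ((1 - t) *\<^sub>R a + t *\<^sub>R b) *\<^sub>R d = (1 - t) *\<^sub>R (y + a *\<^sub>R d) + t *\<^sub>R (y + b *\<^sub>R d)"
      by (simp add: algebra_simps)
    then show "f (y + ((1 - t) *\<^sub>R a + t *\<^sub>R b) *\<^sub>R d)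
        \<le> (1 - t) * f (y + a *\<^sub>R d) + t * f (y + b *\<^sub>R d)"
      using convex_onD[OF assms(1), of t "y + a *\<^sub>R d" "y + b *\<^sub>R d"] t by simp
  qed simp
  have "f (y + 1 *\<^sub>R d) - f (y + 0 *\<^sub>R d) \<ge> (grad f (y + 0 *\<^sub>R d) \<bullet> d) * (1 - 0)"
    using convex_on_imp_above_tangent[OF cv, of 0 1 "grad f (y + 0 *\<^sub>R d) \<bullet> d"]
      smooth_fun_deriv_along_line[OF assms(2), of y d 0] by simp
  then show ?thesis by (simp add: d_def)
qed

text \<open>
  Along the segment from \<open>y\<close> to \<open>w\<close>, the difference between \<open>f\<close> and its quadratic upper model has
  nonpositive derivative, because the gradient changes by at most \<open>L s \<parallel>w - y\<parallel>\<close>.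
\<close>

lemma descent_lemma:
  fixes f :: "'a::euclidean_space \<Rightarrow> real"
  assumes "smooth_fun L f"
  shows "f w \<le> f y + grad f y \<bullet> (w - y) + L / 2 * (norm (w - y))\<^sup>2"
proof -
  define d where "d = w - y"
  define F where "F s = f (y + s *\<^sub>R d) - s * (grad f y \<bullet> d) - L / 2 * s\<^sup>2 * (norm d)\<^sup>2" for s
  have "F 1 \<le> F 0"
  proof (rule DERIV_nonpos_imp_nonincreasing[where f = F])
    fix s :: real assume s: "0 \<le> s" "s \<le> 1"
    define D where "D = grad f (y + s *\<^sub>R d) \<bullet> d - grad f y \<bullet> d - L * s * (norm d)\<^sup>2"
    have "(F has_real_derivative D) (at s)"
      unfolding F_def D_def
      by (auto intro!: derivative_eq_intros smooth_fun_deriv_along_line[OF assms])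
    moreover have "D \<le> 0"
    proof -
      have "(grad f (y + s *\<^sub>R d) - grad f y) \<bullet> d \<le> norm (grad f (y + s *\<^sub>R d) - grad f y) * norm d"
        by (rule norm_cauchy_schwarz)
      also have "norm (grad f (y + s *\<^sub>R d) - grad f y) \<le> L * norm (s *\<^sub>R d)"
        using assms lipschitz_onD[of L UNIV "grad f" "y + s *\<^sub>R d" y]
        by (simp add: smooth_fun_def dist_norm)
      finally have "(grad f (y + s *\<^sub>R d) - grad f y) \<bullet> d \<le> L * norm (s *\<^sub>R d) * norm d"
        by (simp add: mult_right_mono)
      then show ?thesis using s by (simp add: D_def inner_diff_left power2_eq_square mult.assoc)
    qed
    ultimately show "\<exists>D. (F has_real_derivative D) (at s) \<and> D \<le> 0" by blast
  qed simp
  then show ?thesis by (simp add: F_def d_def)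
qed

section \<open>The step-size search\<close>

text \<open>
  The loop terminates because the number of further reductions that would bring the candidate down to
  at most \<open>c\<close> decreases with every pass.
\<close>

lemma while_geometric_search:
  fixes \<tau> c s :: real
  assumes \<tau>: "0 < \<tau>" "\<tau> < 1" and "0 < c" "0 < s"
    and accept: "\<And>\<gamma>. 0 < \<gamma> \<Longrightarrow> \<gamma> \<le> c \<Longrightarrow> \<not> b \<gamma>"
  defines "r \<equiv> while b (\<lambda>\<gamma>. \<tau> * \<gamma>) s"
  shows "0 < r \<and> r \<le> s \<and> \<not> b r"
proof -
  define m where "m \<gamma> = (LEAST k. \<tau> ^ k * \<gamma> \<le> c)" for \<gamma>
  show ?thesis unfolding r_def
  proof (rule while_rule[where P = "\<lambda>\<gamma>. 0 < \<gamma> \<and> \<gamma> \<le> s" and r = "Wellfounded.measure m"])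
    fix \<gamma> assume \<gamma>: "0 < \<gamma> \<and> \<gamma> \<le> s" and "b \<gamma>"
    have "\<tau> * \<gamma> \<le> s * 1" using \<gamma> \<tau> by (subst mult.commute, intro mult_mono) auto
    then show "0 < \<tau> * \<gamma> \<and> \<tau> * \<gamma> \<le> s" using \<gamma> \<tau> by simp
    have "\<exists>k. \<tau> ^ k * \<gamma> \<le> c"
    proof -
      obtain k where "\<tau> ^ k < c / \<gamma>"
        using real_arch_pow_inv[of "c / \<gamma>" \<tau>] \<gamma> \<tau> \<open>0 < c\<close> by auto
      then show ?thesis using \<gamma> by (intro exI[of _ k]) (simp add: field_simps)
    qed
    then have k: "\<tau> ^ m \<gamma> * \<gamma> \<le> c" unfolding m_def by (rule LeastI_ex)
    moreover have "\<not> \<gamma> \<le> c" using accept \<gamma> \<open>b \<gamma>\<close> by blast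
    ultimately obtain j where j: "m \<gamma> = Suc j" by (cases "m \<gamma>") auto
    have "\<tau> ^ j * (\<tau> * \<gamma>) \<le> c" using k j by (simp add: mult_ac)
    then have "m (\<tau> * \<gamma>) \<le> j" unfolding m_def by (rule Least_le)
    then show "(\<tau> * \<gamma>, \<gamma>) \<in> Wellfounded.measure m" using j by simp
  qed (use \<open>0 < s\<close> in auto)
qed

lemma step_search_accepts:
  fixes f :: "'a::euclidean_space \<Rightarrow> real" and g :: "'a \<Rightarrow> ereal" and z u :: 'a
  assumes "smooth_fun L f" "0 < L" "0 < \<tau>" "\<tau> < 1" "0 < \<gamma>init"
  defines "\<gamma> \<equiv> step_search f g \<tau> z u \<gamma>init"
  shows "0 < \<gamma>" and "\<gamma> \<le> \<gamma>init"
    and "f (primal_step f g z u \<gamma>) \<le> quad_model f z (primal_step f g z u \<gamma>) \<gamma>"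
proof -
  have accept: "f w \<le> quad_model f z w \<eta>" if "0 < \<eta>" "\<eta> \<le> 1 / L" for w \<eta>
  proof -
    have "L / 2 \<le> 1 / (2 * \<eta>)" using that \<open>0 < L\<close> by (simp add: field_simps)
    then have "L / 2 * (norm (w - z))\<^sup>2 \<le> 1 / (2 * \<eta>) * (norm (w - z))\<^sup>2"
      by (intro mult_right_mono) auto
    then show ?thesis using descent_lemma[OF assms(1), of w z] by (simp add: quad_model_def)
  qed
  have "0 < \<gamma> \<and> \<gamma> \<le> \<gamma>init \<and>
      \<not> \<not> f (primal_step f g z u \<gamma>) \<le> quad_model f z (primal_step f g z u \<gamma>) \<gamma>"
    unfolding \<gamma>_def step_search_def
    by (rule while_geometric_search[where c = "1 / L"]) (use assms accept in auto)
  then show "0 < \<gamma>" "\<gamma> \<le> \<gamma>init"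
    "f (primal_step f g z u \<gamma>) \<le> quad_model f z (primal_step f g z u \<gamma>) \<gamma>" by auto
qed

section \<open>Fenchel conjugates\<close>

lemma fenchel_young: "ereal (y \<bullet> u) - h y \<le> fenchel_conj h u"
  unfolding fenchel_conj_def by (rule SUP_upper) simp

lemma proper_fun_fenchel_conj:
  assumes "proper_fun h" "u \<in> eff_dom (fenchel_conj h)"
  shows "proper_fun (fenchel_conj h)"
proof -
  obtain y where y: "y \<in> eff_dom h" using assms by (auto simp: proper_fun_def)
  have "fenchel_conj h v \<noteq> -\<infinity>" for v
    using fenchel_young[of y v h] eff_dom_real[OF assms(1) y]
    by (cases "h y") auto
  then show ?thesis using assms(2) by (auto simp: proper_fun_def)
qed

text \<open>
  A conjugate is a supremum of affine functions.
\<close>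

lemma convex_fun_fenchel_conj:
  assumes "proper_fun h"
  shows "convex_fun (fenchel_conj h)"
  unfolding convex_fun_def
proof (intro allI impI)
  fix u v and a b :: real assume ab: "0 \<le> a" "0 \<le> b" "a + b = 1"
  show "fenchel_conj h (a *\<^sub>R u + b *\<^sub>R v) \<le> ereal a * fenchel_conj h u + ereal b * fenchel_conj h v"
    unfolding fenchel_conj_def[of h "a *\<^sub>R u + b *\<^sub>R v"]
  proof (rule SUP_least)
    fix y
    show "ereal (y \<bullet> (a *\<^sub>R u + b *\<^sub>R v)) - h y
        \<le> ereal a * fenchel_conj h u + ereal b * fenchel_conj h v"
    proof (cases "h y")
      case (real r)
      have "r = a * r + b * r" using ab(3) by (metis distrib_right mult_1)
      then have "ereal (y \<bullet> (a *\<^sub>R u + b *\<^sub>R v)) - h y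
          = ereal a * (ereal (y \<bullet> u) - h y) + ereal b * (ereal (y \<bullet> v) - h y)"
        by (simp add: real inner_add_right algebra_simps)
      also have "\<dots> \<le> ereal a * fenchel_conj h u + ereal b * fenchel_conj h v"
        using ab by (intro add_mono ereal_mult_left_mono fenchel_young) auto
      finally show ?thesis .
    qed (use assms in \<open>auto simp: proper_fun_def\<close>)
  qed
qed

text \<open>
  Along the ray through \<open>u\<close> the linear term grows at rate \<open>(norm u)\<^sup>2\<close> and \<open>h\<close> at rate at most
  \<open>\<beta> * norm u\<close>, so the supremum defining the conjugate is infinite as soon as
  \<open>\<beta> < norm u\<close>.
\<close>

lemma fenchel_conj_dom_bounded:
  fixes h :: "'a::real_inner \<Rightarrow> ereal"
  assumes lip: "lipschitz_fun \<beta> h" and "u \<in> eff_dom (fenchel_conj h)"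
  shows "norm u \<le> \<beta>"
proof (rule ccontr)
  assume n: "\<not> norm u \<le> \<beta>"
  define H where "H y = real_of_ereal (h y)" for y
  have hH: "h y = ereal (H y)" for y
    using lip by (simp add: lipschitz_fun_def H_def ereal_real)
  have hl: "\<beta>-lipschitz_on UNIV H" using lip by (simp add: lipschitz_fun_def H_def[abs_def])
  have \<beta>: "0 \<le> \<beta>" using hl by (rule lipschitz_on_nonneg)
  have "ereal (0 \<bullet> u) - h 0 \<le> fenchel_conj h u" by (rule fenchel_young)
  then obtain K where K: "fenchel_conj h u = ereal K"
    using assms(2) hH by (cases "fenchel_conj h u") (auto simp: eff_dom_def)
  define c where "c = norm u * (norm u - \<beta>)"
  have "0 < norm u" using n \<beta> by linarith
  then have "0 < c" using n unfolding c_def by simp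
  then obtain s :: nat where s: "K + H 0 < real s * c" using reals_Archimedean3 by blast
  have "ereal ((real s *\<^sub>R u) \<bullet> u) - h (real s *\<^sub>R u) \<le> ereal K" using fenchel_young K by metis
  then have "real s * (norm u)\<^sup>2 - H (real s *\<^sub>R u) \<le> K"
    by (simp add: hH power2_norm_eq_inner)
  moreover have "H (real s *\<^sub>R u) \<le> H 0 + \<beta> * (real s * norm u)"
    using lipschitz_onD[OF hl, of "real s *\<^sub>R u" 0] by (simp add: dist_norm)
  ultimately have "real s * c \<le> K + H 0"
    by (simp add: c_def power2_eq_square algebra_simps)
  with s show False by simp
qed

text \<open>
  The subgradient inequality says precisely that \<open>z\<close> attains the supremum defining the conjugate.
\<close>

lemma fenchel_young_equality:
  fixes h :: "'a::real_inner \<Rightarrow> ereal"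
  assumes z: "h z = ereal c" and sub: "\<And>w. h z + ereal (u \<bullet> (w - z)) \<le> h w"
  shows "fenchel_conj h u = ereal (z \<bullet> u - c)"
proof (rule antisym)
  show "fenchel_conj h u \<le> ereal (z \<bullet> u - c)"
    unfolding fenchel_conj_def
  proof (rule SUP_least)
    fix w show "ereal (w \<bullet> u) - h w \<le> ereal (z \<bullet> u - c)"
      using sub[of w] z
      by (cases "h w") (auto simp: inner_diff_right inner_commute algebra_simps)
  qed
  show "ereal (z \<bullet> u - c) \<le> fenchel_conj h u"
    using fenchel_young[of z u h] z by simp
qed

section \<open>Jensen's inequality for ergodic averages\<close>

lemma convex_fun_imp_convex_on:
  assumes "proper_fun \<phi>" "convex_fun \<phi>"
  shows "convex_on (eff_dom \<phi>) (\<lambda>y. real_of_ereal (\<phi> y))"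
proof -
  have *: "a *\<^sub>R y + b *\<^sub>R w \<in> eff_dom \<phi> \<and> real_of_ereal (\<phi> (a *\<^sub>R y + b *\<^sub>R w))
      \<le> a * real_of_ereal (\<phi> y) + b * real_of_ereal (\<phi> w)"
    if yw: "y \<in> eff_dom \<phi>" "w \<in> eff_dom \<phi>" and ab: "0 \<le> a" "0 \<le> b" "a + b = 1" for y w a b
  proof -
    obtain r s where rs: "\<phi> y = ereal r" "\<phi> w = ereal s"
      using eff_dom_real[OF assms(1)] yw by blast
    have "\<phi> (a *\<^sub>R y + b *\<^sub>R w) \<le> ereal (a * r + b * s)"
      using assms(2)[unfolded convex_fun_def, rule_format, OF ab, of y w] by (simp add: rs)
    then show ?thesis using rs assms(1)
      by (cases "\<phi> (a *\<^sub>R y + b *\<^sub>R w)") (auto simp: eff_dom_def proper_fun_def)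
  qed
  then show ?thesis unfolding convex_on_def convex_def by blast
qed

lemma step_sum_pos:
  assumes "\<And>i. 0 < \<gamma> i"
  shows "0 < step_sum \<gamma> (Suc t)"
  unfolding step_sum_def using assms by (intro sum_pos) auto

lemma ergodic_avg_inner:
  assumes "\<And>i. 0 < \<gamma> i"
  shows "step_sum \<gamma> (Suc t) * (ergodic_avg \<gamma> v (Suc t) \<bullet> w) = (\<Sum>i<Suc t. \<gamma> i * (v (Suc i) \<bullet> w))"
  using step_sum_pos[of \<gamma> t, OF assms]
  unfolding ergodic_avg_def inner_scaleR_left inner_sum_left by simp

lemma ergodic_avg_jensen:
  assumes cv: "convex_on C F" and pos: "\<And>i. 0 < \<gamma> i" and C: "\<And>i. v (Suc i) \<in> C"
  shows ergodic_avg_in: "ergodic_avg \<gamma> v (Suc t) \<in> C"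
    and "step_sum \<gamma> (Suc t) * F (ergodic_avg \<gamma> v (Suc t)) \<le> (\<Sum>i<Suc t. \<gamma> i * F (v (Suc i)))"
proof -
  let ?s = "step_sum \<gamma> (Suc t)" and ?I = "{..<Suc t}"
  have s: "0 < ?s" by (rule step_sum_pos[OF pos])
  have avg: "ergodic_avg \<gamma> v (Suc t) = (\<Sum>i\<in>?I. (\<gamma> i / ?s) *\<^sub>R v (Suc i))"
    unfolding ergodic_avg_def scaleR_sum_right by simp
  have one: "(\<Sum>i\<in>?I. \<gamma> i / ?s) = 1"
    using s unfolding sum_divide_distrib[symmetric] by (simp add: step_sum_def)
  have nn: "0 \<le> \<gamma> i / ?s" for i using s pos[of i] by simp
  show "ergodic_avg \<gamma> v (Suc t) \<in> C" unfolding avg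
    using cv by (intro convex_sum one nn C) (auto simp: convex_on_def)
  have "F (ergodic_avg \<gamma> v (Suc t)) \<le> (\<Sum>i\<in>?I. \<gamma> i / ?s * F (v (Suc i)))"
    unfolding avg by (intro convex_on_sum[OF _ _ cv one] nn C) auto
  then have "?s * F (ergodic_avg \<gamma> v (Suc t)) \<le> ?s * (\<Sum>i\<in>?I. \<gamma> i / ?s * F (v (Suc i)))"
    using s by (intro mult_left_mono) auto
  also have "\<dots> = (\<Sum>i\<in>?I. \<gamma> i * F (v (Suc i)))"
    using s by (simp add: sum_distrib_left del: sum.lessThan_Suc)
  finally show "?s * F (ergodic_avg \<gamma> v (Suc t)) \<le> (\<Sum>i<Suc t. \<gamma> i * F (v (Suc i)))" .
qed


section \<open>Decrease of the weighted distance to a reference point\<close>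

text \<open>
  The inequality of one iteration, freed of all functions: the letters stand for the
  values \<open>f' = f x'\<close>, \<open>fz = f z\<close>, \<open>fp = f xp\<close>, \<open>g' = g x'\<close>, \<open>gp = g xp\<close>,
  \<open>h' = h\<^sup>* u'\<close>, \<open>hp = h\<^sup>* up\<close> and \<open>d\<close> for the gradient at \<open>z\<close>. Once \<open>xp\<close> is eliminated
  through the dual update, the claim is a nonnegative combination of the assumptions.
\<close>

lemma saddle_gap_algebra:
  fixes x' u' xp zp up z u d :: "'a::real_inner" and \<gamma> \<delta> :: real
  assumes \<gamma>: "0 < \<gamma>"
    and xp: "xp = zp + \<gamma> *\<^sub>R (up - u)"
    and g: "gp + (1 / \<gamma>) * ((z - \<gamma> *\<^sub>R u - \<gamma> *\<^sub>R d - xp) \<bullet> (x' - xp)) \<le> g'"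
    and f: "fz + d \<bullet> (x' - z) \<le> f'"
    and fp: "fp = fz + d \<bullet> (xp - z) + 1 / (2 * \<gamma>) * (norm (xp - z))\<^sup>2 - \<delta>"
    and h: "hp + (u' - up) \<bullet> zp \<le> h'"
  shows "\<gamma> * ((fp + gp + xp \<bullet> u' - h') - (f' + g' + x' \<bullet> up - hp))
    \<le> ((norm (z - x'))\<^sup>2 + \<gamma>\<^sup>2 * (norm (u - u'))\<^sup>2) / 2
      - ((norm (zp - x'))\<^sup>2 + \<gamma>\<^sup>2 * (norm (up - u'))\<^sup>2) / 2 - \<gamma> * \<delta>"
proof -
  have g2: "\<gamma> * gp + (z - \<gamma> *\<^sub>R u - \<gamma> *\<^sub>R d - xp) \<bullet> (x' - xp) \<le> \<gamma> * g'"
    using mult_left_mono[OF g, of \<gamma>] \<gamma> by (simp add: distrib_left)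
  have f2: "\<gamma> * fz + \<gamma> * (d \<bullet> (x' - z)) \<le> \<gamma> * f'"
    using mult_left_mono[OF f, of \<gamma>] \<gamma> by (simp add: distrib_left)
  have fp2: "\<gamma> * fp = \<gamma> * fz + \<gamma> * (d \<bullet> (xp - z)) + (norm (xp - z))\<^sup>2 / 2 - \<gamma> * \<delta>"
    using \<gamma> by (simp add: fp field_simps)
  have h2: "\<gamma> * hp + \<gamma> * ((u' - up) \<bullet> zp) \<le> \<gamma> * h'"
    using mult_left_mono[OF h, of \<gamma>] \<gamma> by (simp add: distrib_left)
  show ?thesis
    using g2 f2 fp2 h2 unfolding xp
    by (simp only: power2_norm_eq_inner inner_diff_left inner_diff_right inner_add_left
        inner_add_right inner_scaleR_left inner_scaleR_right)
       (simp add: inner_commute power2_eq_square field_simps)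
qed

locale adaptive_three_operator_splitting =
  fixes f :: "'a::euclidean_space \<Rightarrow> real"
    and g h :: "'a \<Rightarrow> ereal"
    and L \<tau> \<beta> :: real
    and \<gamma>init \<gamma> :: "nat \<Rightarrow> real"
    and x z u :: "nat \<Rightarrow> 'a"
  assumes f_convex: "convex_on UNIV f" and L_pos: "0 < L" and f_smooth: "smooth_fun L f"
    and g_proper: "proper_fun g" and g_lsc: "lsc_fun g" and g_convex: "convex_fun g"
    and h_proper: "proper_fun h" and h_lsc: "lsc_fun h" and h_convex: "convex_fun h"
    and \<tau>: "0 < \<tau>" "\<tau> < 1" and \<gamma>init_0: "0 < \<gamma>init 0"
    and iterates: "atos_iterates f g h \<tau> \<gamma>init \<gamma> x z u"
    and variant: "atos_variant1 \<gamma>init \<gamma> \<or>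
      0 < \<beta> \<and> lipschitz_fun \<beta> h \<and> atos_variant2 f \<beta> \<gamma>init \<gamma> x z"
begin

text \<open>
  The amount by which the acceptance test is passed, called \<open>\<delta>\<close> in the second variant.
\<close>

definition slack :: "nat \<Rightarrow> real" where
  "slack t = quad_model f (z t) (x (Suc t)) (\<gamma> t) - f (x (Suc t))"

lemma \<gamma>_search: "\<gamma> t = step_search f g \<tau> (z t) (u t) (\<gamma>init t)"
  and x_Suc: "x (Suc t) = primal_step f g (z t) (u t) (\<gamma> t)"
  and z_Suc: "z (Suc t) = prox (\<gamma> t) h (x (Suc t) + \<gamma> t *\<^sub>R u t)"
  and u_Suc: "u (Suc t) = u t + (1 / \<gamma> t) *\<^sub>R (x (Suc t) - z (Suc t))"
  using iterates by (simp_all add: atos_iterates_def)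

lemma \<gamma>_le_\<gamma>init_Suc: "\<gamma> t \<le> \<gamma>init (Suc t)"
  using variant by (auto simp: atos_variant1_def atos_variant2_def Let_def)

lemma \<gamma>init_pos: "0 < \<gamma>init t"
proof (induction t)
  case (Suc t)
  have "0 < \<gamma> t"
    unfolding \<gamma>_search by (rule step_search_accepts(1)[OF f_smooth L_pos \<tau> Suc.IH])
  then show ?case using \<gamma>_le_\<gamma>init_Suc[of t] by linarith
qed (rule \<gamma>init_0)

lemma \<gamma>_pos: "0 < \<gamma> t"
  and \<gamma>_le_\<gamma>init: "\<gamma> t \<le> \<gamma>init t"
  and slack_nonneg: "0 \<le> slack t"
  using step_search_accepts[OF f_smooth L_pos \<tau> \<gamma>init_pos[of t], where g=g and z="z t" and u="u t"]
  by (simp_all add: slack_def x_Suc \<gamma>_search[symmetric])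

lemma x_Suc_in_dom: "x (Suc t) \<in> eff_dom g"
  unfolding x_Suc primal_step_def
  by (rule prox_in_eff_dom[OF g_proper g_lsc g_convex \<gamma>_pos])

lemma z_Suc_in_dom: "z (Suc t) \<in> eff_dom h"
  unfolding z_Suc by (rule prox_in_eff_dom[OF h_proper h_lsc h_convex \<gamma>_pos])

lemma x_Suc_eq: "x (Suc t) = z (Suc t) + \<gamma> t *\<^sub>R (u (Suc t) - u t)"
  using \<gamma>_pos[of t] by (simp add: u_Suc)

text \<open>
  The dual update is the residual of the proximal step for \<open>h\<close> divided by the step-size.
\<close>

lemma u_Suc_subgradient: "h (z (Suc t)) + ereal (u (Suc t) \<bullet> (w - z (Suc t))) \<le> h w"
proof -
  have "(1 / \<gamma> t) *\<^sub>R (x (Suc t) + \<gamma> t *\<^sub>R u t - z (Suc t)) = u (Suc t)"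
    using \<gamma>_pos[of t] by (simp add: u_Suc algebra_simps)
  then have "u (Suc t) \<bullet> (w - z (Suc t))
      = (1 / \<gamma> t) * ((x (Suc t) + \<gamma> t *\<^sub>R u t - z (Suc t)) \<bullet> (w - z (Suc t)))"
    by (metis inner_scaleR_left)
  then show ?thesis
    using prox_variational_inequality(2)[OF h_proper h_lsc h_convex \<gamma>_pos[of t],
        of "x (Suc t) + \<gamma> t *\<^sub>R u t" w]
    by (simp add: z_Suc)
qed

lemma fenchel_conj_u_Suc:
  "fenchel_conj h (u (Suc t)) = ereal (z (Suc t) \<bullet> u (Suc t) - real_of_ereal (h (z (Suc t))))"
  by (intro fenchel_young_equality eff_dom_real h_proper z_Suc_in_dom u_Suc_subgradient)

lemma u_Suc_in_dom: "u (Suc t) \<in> eff_dom (fenchel_conj h)"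
  by (simp add: eff_dom_def fenchel_conj_u_Suc)

text \<open>
  If the step-size grows, the second variant is in force and both dual points lie in the ball of radius
  \<open>\<beta>\<close>. Their squared distance is at most \<open>(2 * \<beta>)\<^sup>2\<close>, which cancels the factor
  \<open>(2 * \<beta>) powi (-2)\<close> in the growth rule.
\<close>

lemma dual_distance_growth:
  assumes "u' \<in> eff_dom (fenchel_conj h)"
  shows "(\<gamma> (Suc t))\<^sup>2 * (norm (u (Suc t) - u'))\<^sup>2
    \<le> (\<gamma> t)\<^sup>2 * (norm (u (Suc t) - u'))\<^sup>2 + 2 * \<gamma> t * slack t"
proof (cases "\<gamma> (Suc t) \<le> \<gamma> t")
  case True
  then have "(\<gamma> (Suc t))\<^sup>2 \<le> (\<gamma> t)\<^sup>2" using \<gamma>_pos[of "Suc t"] by (intro power_mono) auto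
  then have "(\<gamma> (Suc t))\<^sup>2 * (norm (u (Suc t) - u'))\<^sup>2 \<le> (\<gamma> t)\<^sup>2 * (norm (u (Suc t) - u'))\<^sup>2"
    by (intro mult_right_mono) auto
  moreover have "0 \<le> \<gamma> t * slack t" using \<gamma>_pos[of t] slack_nonneg[of t] by simp
  ultimately show ?thesis by simp
next
  case False
  then have v2: "0 < \<beta>" "lipschitz_fun \<beta> h" "atos_variant2 f \<beta> \<gamma>init \<gamma> x z"
    using variant \<gamma>_le_\<gamma>init[of "Suc t"] by (auto simp: atos_variant1_def)
  define N where "N = (norm (u (Suc t) - u'))\<^sup>2"
  define B where "B = (2 * \<beta>)\<^sup>2"
  have B: "0 < B" using v2(1) by (simp add: B_def)
  have "norm (u (Suc t)) \<le> \<beta>" "norm u' \<le> \<beta>"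
    using fenchel_conj_dom_bounded[OF v2(2)] u_Suc_in_dom assms by blast+
  then have "norm (u (Suc t) - u') \<le> 2 * \<beta>"
    using norm_triangle_ineq4[of "u (Suc t)" u'] by linarith
  then have N: "N \<le> B" unfolding N_def B_def by (intro power_mono) auto
  define a where "a = \<gamma> t * slack t"
  have a: "0 \<le> a" using \<gamma>_pos[of t] slack_nonneg[of t] by (simp add: a_def)
  have "\<gamma>init (Suc t) \<in> {\<gamma> t .. sqrt ((\<gamma> t)\<^sup>2 + a * (2 * \<beta>) powi (-2))}"
    using v2(3) unfolding atos_variant2_def Let_def slack_def a_def by blast
  then have "\<gamma>init (Suc t) \<le> sqrt ((\<gamma> t)\<^sup>2 + a * (2 * \<beta>) powi (-2))"
    by (simp only: atLeastAtMost_iff)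
  also have "(2 * \<beta>) powi (-2) = 1 / B"
    by (simp only: B_def power_int_minus power_int_numeral divide_inverse mult_1_left)
  finally have "\<gamma> (Suc t) \<le> sqrt ((\<gamma> t)\<^sup>2 + a / B)"
    using \<gamma>_le_\<gamma>init[of "Suc t"] by simp
  then have "(\<gamma> (Suc t))\<^sup>2 \<le> (sqrt ((\<gamma> t)\<^sup>2 + a / B))\<^sup>2"
    using \<gamma>_pos[of "Suc t"] by (intro power_mono) auto
  also have "\<dots> = (\<gamma> t)\<^sup>2 + a / B" using a B by simp
  finally have "(\<gamma> (Suc t))\<^sup>2 * N \<le> ((\<gamma> t)\<^sup>2 + a / B) * N"
    by (intro mult_right_mono) (auto simp: N_def)
  also have "\<dots> = (\<gamma> t)\<^sup>2 * N + a * (N / B)" by (simp add: algebra_simps)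
  also have "a * (N / B) \<le> a * 1" using N B a by (intro mult_left_mono) auto
  finally have "(\<gamma> (Suc t))\<^sup>2 * N \<le> (\<gamma> t)\<^sup>2 * N + 2 * a" using a by linarith
  then show ?thesis by (simp add: N_def a_def)
qed

abbreviation "G \<equiv> \<lambda>y. real_of_ereal (g y)"
abbreviation "H \<equiv> \<lambda>v. real_of_ereal (fenchel_conj h v)"
abbreviation "saddle_real y v \<equiv> f y + G y + y \<bullet> v - H v"

text \<open>
  The Lyapunov function of the algorithm: its decrease bounds the saddle gap at every iteration.
\<close>

definition energy :: "'a \<Rightarrow> 'a \<Rightarrow> nat \<Rightarrow> real" where
  "energy x' u' t = (norm (z t - x'))\<^sup>2 + (\<gamma> t)\<^sup>2 * (norm (u t - u'))\<^sup>2"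

lemma fenchel_conj_real:
  assumes "u' \<in> eff_dom (fenchel_conj h)" "v \<in> eff_dom (fenchel_conj h)"
  shows "fenchel_conj h v = ereal (H v)"
  by (rule eff_dom_real[OF proper_fun_fenchel_conj[OF h_proper assms(1)] assms(2)])

lemma gap_le_energy_decrease:
  assumes x': "x' \<in> eff_dom g" and u': "u' \<in> eff_dom (fenchel_conj h)"
  shows "\<gamma> t * (saddle_real (x (Suc t)) u' - saddle_real x' (u (Suc t)))
    \<le> (energy x' u' t - energy x' u' (Suc t)) / 2"
proof -
  let ?xp = "x (Suc t)" and ?zp = "z (Suc t)" and ?up = "u (Suc t)"
  let ?d = "grad f (z t)"
  let ?v = "z t - \<gamma> t *\<^sub>R u t - \<gamma> t *\<^sub>R ?d"
  have "g ?xp + ereal ((1 / \<gamma> t) * ((?v - ?xp) \<bullet> (x' - ?xp))) \<le> g x'"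
    using prox_variational_inequality(2)[OF g_proper g_lsc g_convex \<gamma>_pos[of t], of ?v x']
    by (simp add: x_Suc primal_step_def)
  moreover obtain a b where "g ?xp = ereal a" "g x' = ereal b"
    using eff_dom_real[OF g_proper] x_Suc_in_dom x' by blast
  ultimately have gi: "G ?xp + (1 / \<gamma> t) * ((?v - ?xp) \<bullet> (x' - ?xp)) \<le> G x'" by simp
  obtain c d where "h ?zp = ereal c" "fenchel_conj h u' = ereal d"
    using eff_dom_real[OF h_proper z_Suc_in_dom] fenchel_conj_real[OF u' u'] by blast
  then have "?zp \<bullet> u' - real_of_ereal (h ?zp) \<le> H u'"
    using fenchel_young[of ?zp u' h] by simp
  then have hi: "H ?up + (u' - ?up) \<bullet> ?zp \<le> H u'"
    by (simp add: fenchel_conj_u_Suc inner_diff_left inner_diff_right inner_commute)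
  have "f ?xp = f (z t) + ?d \<bullet> (?xp - z t) + 1 / (2 * \<gamma> t) * (norm (?xp - z t))\<^sup>2 - slack t"
    by (simp add: slack_def quad_model_def)
  note step = saddle_gap_algebra[OF \<gamma>_pos x_Suc_eq gi
      convex_gradient_inequality[OF f_convex f_smooth] this hi]
  have halves: "(A + B) / 2 - (C + D) / 2 - c \<le> (A + B - (C + D')) / 2"
    if "D' \<le> D + 2 * c" for A B C D D' c :: real
    using that by (simp add: field_simps)
  have "(\<gamma> (Suc t))\<^sup>2 * (norm (?up - u'))\<^sup>2
      \<le> (\<gamma> t)\<^sup>2 * (norm (?up - u'))\<^sup>2 + 2 * (\<gamma> t * slack t)"
    using dual_distance_growth[OF u', of t] by (simp add: mult.assoc)
  then have "((norm (z t - x'))\<^sup>2 + (\<gamma> t)\<^sup>2 * (norm (u t - u'))\<^sup>2) / 2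
      - ((norm (?zp - x'))\<^sup>2 + (\<gamma> t)\<^sup>2 * (norm (?up - u'))\<^sup>2) / 2 - \<gamma> t * slack t
      \<le> (energy x' u' t - energy x' u' (Suc t)) / 2"
    unfolding energy_def by (rule halves)
  with step show ?thesis by (rule order_trans)
qed

section \<open>The ergodic saddle gap\<close>

lemma sum_gap_le_initial_energy:
  assumes "x' \<in> eff_dom g" "u' \<in> eff_dom (fenchel_conj h)"
  shows "(\<Sum>i<n. \<gamma> i * (saddle_real (x (Suc i)) u' - saddle_real x' (u (Suc i)))) \<le> energy x' u' 0 / 2"
proof -
  have "(\<Sum>i<n. \<gamma> i * (saddle_real (x (Suc i)) u' - saddle_real x' (u (Suc i))))
      \<le> (\<Sum>i<n. energy x' u' i / 2 - energy x' u' (Suc i) / 2)"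
    by (intro sum_mono) (use gap_le_energy_decrease[OF assms] in \<open>simp add: diff_divide_distrib\<close>)
  also have "\<dots> = energy x' u' 0 / 2 - energy x' u' n / 2" by (rule sum_lessThan_telescope')
  also have "\<dots> \<le> energy x' u' 0 / 2"
  proof -
    have "0 \<le> energy x' u' n" by (simp add: energy_def)
    then show ?thesis by linarith
  qed
  finally show ?thesis .
qed

lemma ergodic_gap_bound:
  assumes x': "x' \<in> eff_dom g" and u': "u' \<in> eff_dom (fenchel_conj h)"
  shows "saddle f g h (ergodic_avg \<gamma> x (Suc t)) u' - saddle f g h x' (ergodic_avg \<gamma> u (Suc t))
    \<le> ereal (energy x' u' 0 / (2 * step_sum \<gamma> (Suc t)))"
proof -
  define s where "s = step_sum \<gamma> (Suc t)"
  define xa where "xa = ergodic_avg \<gamma> x (Suc t)"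
  define ua where "ua = ergodic_avg \<gamma> u (Suc t)"
  note defs = s_def xa_def ua_def
  have s: "0 < s" unfolding s_def by (rule step_sum_pos[of \<gamma>, OF \<gamma>_pos])
  note Hp = proper_fun_fenchel_conj[OF h_proper u']
  note Gc = convex_fun_imp_convex_on[OF g_proper g_convex]
  note Hc = convex_fun_imp_convex_on[OF Hp convex_fun_fenchel_conj[OF h_proper]]
  have xa: "xa \<in> eff_dom g" unfolding xa_def by (rule ergodic_avg_in[where v = x and \<gamma> = \<gamma>, OF Gc \<gamma>_pos x_Suc_in_dom])
  have ua: "ua \<in> eff_dom (fenchel_conj h)"
    unfolding ua_def by (rule ergodic_avg_in[where v = u and \<gamma> = \<gamma>, OF Hc \<gamma>_pos u_Suc_in_dom])
  have J: "s * f xa \<le> (\<Sum>i<Suc t. \<gamma> i * f (x (Suc i)))"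
    unfolding defs by (rule ergodic_avg_jensen(2)[where v = x and \<gamma> = \<gamma>, OF f_convex \<gamma>_pos UNIV_I])
  have JG: "s * G xa \<le> (\<Sum>i<Suc t. \<gamma> i * G (x (Suc i)))"
    unfolding defs by (rule ergodic_avg_jensen(2)[where v = x and \<gamma> = \<gamma>, OF Gc \<gamma>_pos x_Suc_in_dom])
  have JH: "s * H ua \<le> (\<Sum>i<Suc t. \<gamma> i * H (u (Suc i)))"
    unfolding defs by (rule ergodic_avg_jensen(2)[where v = u and \<gamma> = \<gamma>, OF Hc \<gamma>_pos u_Suc_in_dom])
  have Ix: "s * (xa \<bullet> u') = (\<Sum>i<Suc t. \<gamma> i * (x (Suc i) \<bullet> u'))"
    unfolding defs by (rule ergodic_avg_inner[where v = x and \<gamma> = \<gamma>, OF \<gamma>_pos])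
  have Iu: "s * (ua \<bullet> x') = (\<Sum>i<Suc t. \<gamma> i * (u (Suc i) \<bullet> x'))"
    unfolding defs by (rule ergodic_avg_inner[where v = u and \<gamma> = \<gamma>, OF \<gamma>_pos])
  have const: "s * c = (\<Sum>i<Suc t. \<gamma> i * c)" for c
    unfolding s_def step_sum_def by (rule sum_distrib_right)
  define gap where "gap = saddle_real xa u' - saddle_real x' ua"
  have "s * gap = s * f xa + s * G xa + s * (xa \<bullet> u') + s * H ua - s * (ua \<bullet> x')
      - s * (H u' + f x' + G x')"
    by (simp add: gap_def inner_commute algebra_simps)
  also have "\<dots> \<le> (\<Sum>i<Suc t. \<gamma> i * f (x (Suc i))) + (\<Sum>i<Suc t. \<gamma> i * G (x (Suc i)))
      + (\<Sum>i<Suc t. \<gamma> i * (x (Suc i) \<bullet> u')) + (\<Sum>i<Suc t. \<gamma> i * H (u (Suc i)))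
      - (\<Sum>i<Suc t. \<gamma> i * (u (Suc i) \<bullet> x')) - (\<Sum>i<Suc t. \<gamma> i * (H u' + f x' + G x'))"
    using J JG JH Ix Iu const[of "H u' + f x' + G x'"] by linarith
  also have "\<dots> = (\<Sum>i<Suc t. \<gamma> i * (saddle_real (x (Suc i)) u' - saddle_real x' (u (Suc i))))"
    unfolding sum.distrib[symmetric] sum_subtractf[symmetric]
    by (intro sum.cong refl) (simp add: inner_commute algebra_simps)
  also have "\<dots> \<le> energy x' u' 0 / 2" by (rule sum_gap_le_initial_energy[OF x' u'])
  finally have "gap \<le> energy x' u' 0 / (2 * s)" using s by (simp add: pos_le_divide_eq mult_ac)
  have saddle: "saddle f g h y v = ereal (saddle_real y v)"
    if yv: "y \<in> eff_dom g" "v \<in> eff_dom (fenchel_conj h)" for y v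
  proof -
    obtain a b where "g y = ereal a" "fenchel_conj h v = ereal b"
      using eff_dom_real[OF g_proper] fenchel_conj_real[OF u'] yv by blast
    then show ?thesis by (simp add: saddle_def)
  qed
  from \<open>gap \<le> _\<close> have "saddle f g h xa u' - saddle f g h x' ua \<le> ereal (energy x' u' 0 / (2 * s))"
    unfolding gap_def saddle[OF xa u'] saddle[OF x' ua] by (simp only: ereal_minus ereal_less_eq)
  then show ?thesis unfolding defs .
qed

end

theorem theorem2:
  fixes f :: "real ^ 'p \<Rightarrow> real"
    and g h :: "real ^ 'p \<Rightarrow> ereal"
    and L \<tau> \<beta> :: real
    and \<gamma>init \<gamma> :: "nat \<Rightarrow> real"
    and x z u :: "nat \<Rightarrow> real ^ 'p"
  assumes "convex_on UNIV f" and "0 < L" and "smooth_fun L f"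
    and "proper_fun g" and "lsc_fun g" and "convex_fun g"
    and "proper_fun h" and "lsc_fun h" and "convex_fun h"
    and "rel_interior (eff_dom g) \<inter> rel_interior (eff_dom h) \<noteq> {}"
    and "0 < \<tau>" and "\<tau> < 1" and "0 < \<gamma>init 0"
    and "atos_iterates f g h \<tau> \<gamma>init \<gamma> x z u"
    and "atos_variant1 \<gamma>init \<gamma> \<or>
         0 < \<beta> \<and> lipschitz_fun \<beta> h \<and> atos_variant2 f \<beta> \<gamma>init \<gamma> x z"
  shows "\<forall>t. \<forall>(x', u') \<in> saddle_dom g h.
    saddle f g h (ergodic_avg \<gamma> x (Suc t)) u' - saddle f g h x' (ergodic_avg \<gamma> u (Suc t))
      \<le> ereal (((norm (z 0 - x'))\<^sup>2 + (\<gamma> 0)\<^sup>2 * (norm (u 0 - u'))\<^sup>2) / (2 * step_sum \<gamma> (Suc t)))"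
proof -
  interpret adaptive_three_operator_splitting f g h L \<tau> \<beta> \<gamma>init \<gamma> x z u
    using assms by unfold_locales
  show ?thesis
  proof (intro allI ballI, clarify)
    fix t x' u' assume "(x', u') \<in> saddle_dom g h"
    then have "x' \<in> eff_dom g" "u' \<in> eff_dom (fenchel_conj h)"
      by (simp_all add: saddle_dom_def)
    from ergodic_gap_bound[OF this, of t]
    show "saddle f g h (ergodic_avg \<gamma> x (Suc t)) u' - saddle f g h x' (ergodic_avg \<gamma> u (Suc t))
      \<le> ereal (((norm (z 0 - x'))\<^sup>2 + (\<gamma> 0)\<^sup>2 * (norm (u 0 - u'))\<^sup>2) / (2 * step_sum \<gamma> (Suc t)))"
      by (simp only: energy_def)
  qed
qed

end
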